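(* Let $m$ be a positive integer, $\Lambda_1,\dots,\Lambda_{m-1}\ge0$ and $\Lambda_0>1$. Let $F(z)=\sum_{k=0}^{m-1}\bar z^k f_k(z)$ be a poly-analytic function on $\mathbb{D}$, where all $f_k$ are holomorphic on $\mathbb{D}$, satisfying $f_k(0)=0$ for $k\in\{0,1,\dots,m-1\}$ and $F_z(0)=1$. If $|f_0'(z)|<\Lambda_0$ and $|f_k'(z)|\le\Lambda_k$ for $k\in\{1,\dots,m-1\}$, for all $z\in\mathbb{D}$, then $F$ is univalent in $\mathbb{D}_{r_3}$, and $F(\mathbb{D}_{r_3})$ contains a schlicht disc $\mathbb{D}_{R_3}$, where $r_3$ is the unique root in $(0,1)$ of the equation $$\Lambda_0\frac{1-\Lambda_0 r}{\Lambda_0-r}-\sum_{k=1}^{m-1}(k+1)\Lambda_k r^k=0$$ and $$R_3=\Lambda_0^2 r_3+(\Lambda_0^3-\Lambda_0)\ln\left(1-\frac{r_3}{\Lambda_0}\right)-\sum_{k=1}^{m-1}\Lambda_k r_3^{k+1}.$$ Moreover, these estimates are sharp, with an extremal function given by $$F_0(z)=\Lambda_0^2 z+(\Lambda_0^3-\Lambda_0)\ln\left(1-\frac{z}{\Lambda_0}\right)-\sum_{k=1}^{m-1}\bar z^k\Lambda_k z,\quad z\in\mathbb{D};$$ that is, $F_0$ satisfies all the hypotheses above, $F_0$ is not univalent in $\mathbb{D}_r$ for any $r\in(r_3,1]$, and $F_0(\mathbb{D}_{r_3})$ does not contain $\mathbb{D}_R$ for any $R>R_3$.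
   Context: $\mathbb{D}=\{z\in\mathbb{C}:|z|<1\}$ and $\mathbb{D}_r=\{z\in\mathbb{C}:|z|<r\}$. A complex-valued $C^m$ function $F$ on a domain is poly-analytic of order $m\ge1$ if $\partial^m F/\partial\bar z^m=0$; equivalently $F(z)=\sum_{k=0}^{m-1}\bar z^k f_k(z)$ with $f_k$ analytic. $F_z=\partial F/\partial z$ is the Wirtinger derivative. Univalent means injective. "$F(\mathbb{D}_{r})$ contains a schlicht disc $\mathbb{D}_{R}$" means that some subdomain of $\mathbb{D}_r$ is mapped injectively by $F$ onto $\mathbb{D}_R$; as $F$ is univalent in $\mathbb{D}_r$ this amounts to $\mathbb{D}_R\subseteq F(\mathbb{D}_r)$. $\ln$ is the principal branch of the logarithm. Empty sums are $0$. *)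

theory Defs
  imports "HOL-Complex_Analysis.Complex_Analysis"
begin

text \<open>The Wirtinger derivative \<open>\<partial>F/\<partial>z = (\<partial>F/\<partial>x - \<i> \<partial>F/\<partial>y) / 2\<close>; the two partial derivatives
  are the values of the real Frechet derivative in the directions \<open>1\<close> and \<open>\<i>\<close>.\<close>

definition wirtinger_dz :: "(complex \<Rightarrow> complex) \<Rightarrow> complex \<Rightarrow> complex" where
  "wirtinger_dz F z =
     (frechet_derivative F (at z) 1 - \<i> * frechet_derivative F (at z) \<i>) / 2"

text \<open>\<open>F\<close> is poly-analytic of order \<open>m\<close> on \<open>S\<close>, with analytic components \<open>f 0, \<dots>, f (m - 1)\<close>.
  The components are kept explicit because bounds are imposed on them; \<open>f k\<close> is irrelevant
  for \<open>k \<ge> m\<close>, and so are the values of \<open>F\<close> outside \<open>S\<close>.\<close>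

definition polyanalytic_with ::
    "nat \<Rightarrow> (nat \<Rightarrow> complex \<Rightarrow> complex) \<Rightarrow> (complex \<Rightarrow> complex) \<Rightarrow> complex set \<Rightarrow> bool" where
  "polyanalytic_with m f F S \<longleftrightarrow>
     (\<forall>k<m. f k holomorphic_on S) \<and> (\<forall>z\<in>S. F z = (\<Sum>k<m. cnj z ^ k * f k z))"

definition landau_hypotheses ::
    "nat \<Rightarrow> (nat \<Rightarrow> real) \<Rightarrow> (nat \<Rightarrow> complex \<Rightarrow> complex) \<Rightarrow> (complex \<Rightarrow> complex) \<Rightarrow> bool" where
  "landau_hypotheses m \<Lambda> f F \<longleftrightarrow>
     polyanalytic_with m f F (ball 0 1) \<and>
     (\<forall>k<m. f k 0 = 0) \<and>
     wirtinger_dz F 0 = 1 \<and>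
     (\<forall>z\<in>ball 0 1. norm (deriv (f 0) z) < \<Lambda> 0) \<and>
     (\<forall>k\<in>{1..<m}. \<forall>z\<in>ball 0 1. norm (deriv (f k) z) \<le> \<Lambda> k)"

text \<open>Some subdomain of \<open>S\<close> is mapped by \<open>F\<close> injectively onto the disc of radius \<open>R\<close> about \<open>0\<close>.
  As a domain is nonempty, this includes \<open>R > 0\<close>.\<close>

definition contains_schlicht_disc ::
    "(complex \<Rightarrow> complex) \<Rightarrow> complex set \<Rightarrow> real \<Rightarrow> bool" where
  "contains_schlicht_disc F S R \<longleftrightarrow>
     (\<exists>U\<subseteq>S. U \<noteq> {} \<and> open U \<and> connected U \<and> bij_betw F U (ball 0 R))"

definition radius_equation :: "nat \<Rightarrow> (nat \<Rightarrow> real) \<Rightarrow> real \<Rightarrow> bool" where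
  "radius_equation m \<Lambda> r \<longleftrightarrow>
     \<Lambda> 0 * ((1 - \<Lambda> 0 * r) / (\<Lambda> 0 - r)) - (\<Sum>k=1..<m. (real k + 1) * \<Lambda> k * r ^ k) = 0"

definition schlicht_radius :: "nat \<Rightarrow> (nat \<Rightarrow> real) \<Rightarrow> real \<Rightarrow> real" where
  "schlicht_radius m \<Lambda> r =
     (\<Lambda> 0)\<^sup>2 * r + ((\<Lambda> 0) ^ 3 - \<Lambda> 0) * ln (1 - r / \<Lambda> 0) - (\<Sum>k=1..<m. \<Lambda> k * r ^ (k + 1))"

definition extremal_fun :: "nat \<Rightarrow> (nat \<Rightarrow> real) \<Rightarrow> complex \<Rightarrow> complex" where
  "extremal_fun m \<Lambda> z =
     of_real ((\<Lambda> 0)\<^sup>2) * z + of_real ((\<Lambda> 0) ^ 3 - \<Lambda> 0) * Ln (1 - z / of_real (\<Lambda> 0))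
     - (\<Sum>k=1..<m. cnj z ^ k * of_real (\<Lambda> k) * z)"

end

theory Submission
  imports Defs
begin

text \<open>The left-hand side of the radius equation (\<open>slope\<close> below) is the derivative of
  \<open>schlicht_radius m \<Lambda>\<close>. By the Schwarz-Pick lemma for \<open>f\<^sub>0'\<close>, the derivative \<open>F'\<close> of \<open>F\<close> at \<open>z\<close>
  satisfies \<open>Re (cnj w * F' w) \<ge> slope m \<Lambda> \<bar>z\<bar> * \<bar>w\<bar>\<^sup>2\<close>. Integrated along a chord of the disc
  of radius \<open>r\<^sub>3\<close>, where the slope is positive, this gives injectivity; integrated along a radius,
  it gives \<open>\<bar>F z\<bar> \<ge> schlicht_radius m \<Lambda> \<bar>z\<bar>\<close>, and the covered disc follows from invariance
  of domain and a connectedness argument.\<close>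

section \<open>The radius equation in partial fractions\<close>

definition slope :: "nat \<Rightarrow> (nat \<Rightarrow> real) \<Rightarrow> real \<Rightarrow> real" where
  "slope m \<Lambda> r =
     \<Lambda> 0 * ((1 - \<Lambda> 0 * r) / (\<Lambda> 0 - r)) - (\<Sum>k=1..<m. (real k + 1) * \<Lambda> k * r ^ k)"

lemma radius_equation_iff_slope: "radius_equation m \<Lambda> r \<longleftrightarrow> slope m \<Lambda> r = 0"
  by (simp add: radius_equation_def slope_def)

text \<open>With \<open>r\<close> confined to a single simple pole, both the monotonicity in
  \<open>r\<close> and the logarithm in the antiderivative become visible.\<close>

lemma pick_bound_eq:
  fixes L r :: real
  assumes "r < L"
  shows "L * ((1 - L * r) / (L - r)) = L\<^sup>2 - (L ^ 3 - L) / (L - r)"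
  using assms by (simp add: field_simps power2_eq_square power3_eq_cube)

lemma slope_eq:
  assumes "r < \<Lambda> 0"
  shows "slope m \<Lambda> r = (\<Lambda> 0)\<^sup>2 - (\<Lambda> 0 ^ 3 - \<Lambda> 0) / (\<Lambda> 0 - r)
    - (\<Sum>k=1..<m. (real k + 1) * \<Lambda> k * r ^ k)"
  using assms by (simp only: slope_def pick_bound_eq)

section \<open>A Schwarz-Pick lower bound for the real part\<close>

lemma norm_sq_diff_eq:
  fixes z :: complex and a :: real
  shows "(norm (of_real a - z))\<^sup>2 = a\<^sup>2 - 2 * a * Re z + (norm z)\<^sup>2"
  unfolding cmod_power2 by (simp add: power2_eq_square algebra_simps)

text \<open>Normalising \<open>g / L\<close> by a disc automorphism gives a self-map
  \<open>h\<close> of the disc fixing 0, so the Schwarz lemma yields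
  \<open>norm (h z) \<le> norm z\<close>. Solving for \<open>g\<close> gives
  \<open>g z = L^2 - (L^3 - L) / (L + h z)\<close>, and the quotient has modulus at most
  \<open>(L^3 - L) / (L - norm z)\<close>.\<close>

lemma Schwarz_Pick_Re_bound:
  fixes L :: real
  assumes "L > 1" and holo: "g holomorphic_on ball 0 1" and "g 0 = 1"
    and bound: "\<And>z. norm z < 1 \<Longrightarrow> norm (g z) < L" and z: "norm z < 1"
  shows "L * ((1 - L * norm z) / (L - norm z)) \<le> Re (g z)"
proof -
  \<comment> \<open>the disc automorphism taking \<open>1 / L\<close> to \<open>0\<close>, applied to \<open>g / L\<close>\<close>
  define h where "h w = of_real L * (g w - 1) / (of_real (L\<^sup>2) - g w)" for w
  have LL: "L < L\<^sup>2"
    using \<open>L > 1\<close> by (simp add: power2_eq_square)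
  have nz: "of_real (L\<^sup>2) - g w \<noteq> 0" if "norm w < 1" for w
  proof
    assume "of_real (L\<^sup>2) - g w = 0"
    then have "g w = of_real (L\<^sup>2)" by simp
    then have "norm (g w) = L\<^sup>2" by (simp del: of_real_power)
    with bound[OF that] LL show False by simp
  qed
  have h_bound: "norm (h w) < 1" if "norm w < 1" for w
  proof -
    \<comment> \<open>The terms in \<open>Re (g w)\<close> cancel in this difference, and the
      remaining product is positive because \<open>norm (g w) < L\<close> and
      \<open>L > 1\<close>.\<close>
    have "(norm (of_real (L\<^sup>2) - g w))\<^sup>2 - L\<^sup>2 * (norm (of_real 1 - g w))\<^sup>2
        = (L\<^sup>2 - 1) * (L\<^sup>2 - (norm (g w))\<^sup>2)"
      unfolding norm_sq_diff_eq by (simp add: algebra_simps power2_eq_square)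
    moreover have "(norm (g w))\<^sup>2 < L\<^sup>2"
      using bound[OF that] by (intro power_strict_mono) auto
    moreover have "L\<^sup>2 > 1" using LL \<open>L > 1\<close> by simp
    ultimately have "L\<^sup>2 * (norm (of_real 1 - g w))\<^sup>2 < (norm (of_real (L\<^sup>2) - g w))\<^sup>2"
      by (smt (verit) mult_pos_pos)
    then have "(L * norm (g w - 1))\<^sup>2 < (norm (of_real (L\<^sup>2) - g w))\<^sup>2"
      by (simp add: power_mult_distrib norm_minus_commute)
    then have "L * norm (g w - 1) < norm (of_real (L\<^sup>2) - g w)"
      by (rule power_less_imp_less_base) simp
    then show ?thesis
      using nz[OF that] \<open>L > 1\<close> unfolding h_def norm_divide norm_mult by (simp del: of_real_power)
  qed
  have "h holomorphic_on ball 0 1"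
    unfolding h_def using nz by (intro holomorphic_intros holo) auto
  moreover have "h 0 = 0" by (simp add: h_def \<open>g 0 = 1\<close>)
  ultimately have hz: "norm (h z) \<le> norm z"
    using Schwarz_Lemma(1)[of h z] h_bound z by blast
  have ge: "L - norm z \<le> norm (of_real L + h z)"
    using hz norm_diff_ineq[of "of_real L" "h z"] \<open>L > 1\<close> by simp
  have pos: "0 < L - norm z" using z \<open>L > 1\<close> by simp
  have nz': "of_real L + h z \<noteq> 0" using ge pos by auto
  \<comment> \<open>Adding \<open>L\<close> cancels \<open>g z\<close> from the numerator of
    \<open>h z\<close>, so the relation can be solved for \<open>g z\<close>.\<close>
  have "of_real L + h z = of_real (L ^ 3 - L) / (of_real (L\<^sup>2) - g z)"
    using nz[OF z] by (simp add: h_def field_simps power2_eq_square power3_eq_cube)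
  then have "(of_real L + h z) * (of_real (L\<^sup>2) - g z) = of_real (L ^ 3 - L)"
    using nz[OF z] by (simp only: nonzero_eq_divide_eq not_False_eq_True)
  then have "of_real (L\<^sup>2) - g z = of_real (L ^ 3 - L) / (of_real L + h z)"
    using nz' by (simp only: nonzero_eq_divide_eq mult.commute not_False_eq_True)
  then have "g z = of_real (L\<^sup>2) - of_real (L ^ 3 - L) / (of_real L + h z)"
    by (metis diff_diff_eq2 add_diff_cancel_left')
  then have "Re (g z) = L\<^sup>2 - Re (of_real (L ^ 3 - L) / (of_real L + h z))"
    by (simp del: of_real_power of_real_diff)
  moreover have "Re (of_real (L ^ 3 - L) / (of_real L + h z)) \<le> (L ^ 3 - L) / (L - norm z)"
  proof -
    have "0 \<le> L ^ 3 - L"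
      using self_le_power[of L 3] \<open>L > 1\<close> by simp
    then have "norm (of_real (L ^ 3 - L) / (of_real L + h z)) \<le> (L ^ 3 - L) / (L - norm z)"
      unfolding norm_divide norm_of_real using ge pos by (simp add: frac_le)
    with complex_Re_le_cmod show ?thesis by (rule order_trans)
  qed
  ultimately show ?thesis
    using pick_bound_eq[of "norm z" L] pos by simp
qed

section \<open>Derivatives of poly-analytic functions\<close>

text \<open>Product rule: the holomorphic factors feed the complex-linear part, the powers of
  \<open>cnj z\<close> the conjugate-linear part. For \<open>k = 0\<close> the factor
  \<open>of_nat k\<close> removes the term with the truncated exponent \<open>k - 1\<close>.\<close>

lemma polyanalytic_has_derivative:
  assumes "polyanalytic_with m f F S" and "open S" and z: "z \<in> S"
  shows "(F has_derivative
           (\<lambda>h. (\<Sum>k<m. cnj z ^ k * deriv (f k) z) * h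
              + (\<Sum>k<m. of_nat k * cnj z ^ (k - 1) * f k z) * cnj h)) (at z)"
proof -
  have eq: "F w = (\<Sum>k<m. cnj w ^ k * f k w)" if "w \<in> S" for w
    using assms(1) that by (simp add: polyanalytic_with_def)
  have d: "(f k has_derivative (\<lambda>h. deriv (f k) z * h)) (at z)" if "k < m" for k
    using assms that holomorphic_derivI[of "f k" S z]
    by (simp add: polyanalytic_with_def has_field_derivative_def)
  have "((\<lambda>w. \<Sum>k<m. cnj w ^ k * f k w) has_derivative
           (\<lambda>h. \<Sum>k<m. cnj z ^ k * (deriv (f k) z * h)
              + of_nat k * cnj h * cnj z ^ (k - 1) * f k z)) (at z)"
    by (auto intro!: derivative_eq_intros d simp: algebra_simps)
  then have "((\<lambda>w. \<Sum>k<m. cnj w ^ k * f k w) has_derivative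
           (\<lambda>h. (\<Sum>k<m. cnj z ^ k * deriv (f k) z) * h
              + (\<Sum>k<m. of_nat k * cnj z ^ (k - 1) * f k z) * cnj h)) (at z)"
    by (simp add: sum.distrib sum_distrib_right sum_distrib_left mult_ac)
  \<comment> \<open>\<open>F\<close> agrees with the sum only on \<open>S\<close>; openness of
    \<open>S\<close> makes this enough at \<open>z\<close>.\<close>
  then show ?thesis
    by (rule has_derivative_transform_within_open[OF _ \<open>open S\<close> z]) (simp add: eq)
qed

text \<open>The Wirtinger operator keeps the complex-linear coefficient:
  \<open>((A + B) - \<i> * (\<i> * A - \<i> * B)) / 2 = A\<close>.\<close>

lemma wirtinger_dz_polyanalytic:
  assumes "polyanalytic_with m f F S" and "open S" and "z \<in> S"
  shows "wirtinger_dz F z = (\<Sum>k<m. cnj z ^ k * deriv (f k) z)"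
proof -
  define A B where "A = (\<Sum>k<m. cnj z ^ k * deriv (f k) z)"
    and "B = (\<Sum>k<m. of_nat k * cnj z ^ (k - 1) * f k z)"
  have "frechet_derivative F (at z) = (\<lambda>h. A * h + B * cnj h)"
    using polyanalytic_has_derivative[OF assms] unfolding A_def B_def
    by (rule frechet_derivative_at[symmetric])
  then show ?thesis
    unfolding A_def[symmetric] by (simp add: wirtinger_dz_def algebra_simps)
qed

text \<open>At 0 only the term \<open>k = 0\<close> survives, as \<open>0 ^ 0 = 1\<close>. The
  normalisation of \<open>F\<close> thus becomes the one that the Schwarz-Pick bound requires of the
  derivative of \<open>f 0\<close>.\<close>

lemma wirtinger_dz_polyanalytic_0:
  assumes "polyanalytic_with m f F (ball 0 1)" and "m \<ge> 1"
  shows "wirtinger_dz F 0 = deriv (f 0) 0"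
proof -
  have "wirtinger_dz F 0 = (\<Sum>k<m. 0 ^ k * deriv (f k) 0)"
    using wirtinger_dz_polyanalytic[OF assms(1), of 0] by simp
  also have "\<dots> = (\<Sum>k\<in>{0}. 0 ^ k * deriv (f k) 0)"
    using assms(2) by (intro sum.mono_neutral_right) auto
  finally show ?thesis by simp
qed

lemma lessThan_split_0: "m \<ge> 1 \<Longrightarrow> sum g {..<m} = g 0 + sum g {1..<m}"
  for g :: "nat \<Rightarrow> 'a::comm_monoid_add"
  by (simp add: sum.atLeast_Suc_lessThan lessThan_atLeast0)

section \<open>Monotonicity of the slope and the root of the radius equation\<close>

locale landau_weights =
  fixes m :: nat and \<Lambda> :: "nat \<Rightarrow> real"
  assumes m_ge_1: "m \<ge> 1"
    and weight_nonneg: "k \<in> {1..<m} \<Longrightarrow> \<Lambda> k \<ge> 0"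
    and weight_0_gt_1: "\<Lambda> 0 > 1"
begin

text \<open>Strictness comes from the pole term, since
  \<open>\<Lambda> 0 ^ 3 - \<Lambda> 0 > 0\<close>; the sum is only weakly monotone, as its weights
  may vanish.\<close>

lemma slope_strict_decreasing:
  assumes "0 \<le> r" "r < s" "s \<le> 1"
  shows "slope m \<Lambda> s < slope m \<Lambda> r"
proof -
  have L: "\<Lambda> 0 ^ 3 - \<Lambda> 0 > 0"
    using power_strict_increasing[of 1 3 "\<Lambda> 0"] weight_0_gt_1 by simp
  have "(\<Lambda> 0 ^ 3 - \<Lambda> 0) / (\<Lambda> 0 - r) < (\<Lambda> 0 ^ 3 - \<Lambda> 0) / (\<Lambda> 0 - s)"
    using L assms weight_0_gt_1 by (intro divide_strict_left_mono) auto
  moreover have "(\<Sum>k=1..<m. (real k + 1) * \<Lambda> k * r ^ k) \<le> (\<Sum>k=1..<m. (real k + 1) * \<Lambda> k * s ^ k)"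
    using assms weight_nonneg by (intro sum_mono mult_left_mono power_mono) auto
  ultimately show ?thesis
    using assms weight_0_gt_1 by (simp add: slope_eq)
qed

lemma continuous_on_slope: "continuous_on {0..1} (slope m \<Lambda>)"
  unfolding slope_def using weight_0_gt_1 by (intro continuous_intros) auto

text \<open>Intermediate value theorem: the slope is 1 at 0 and at most \<open>- \<Lambda> 0\<close>
  at 1. Strict monotonicity gives uniqueness.\<close>

lemma radius_equation_ex1: "\<exists>!r. r \<in> {0<..<1} \<and> radius_equation m \<Lambda> r"
proof -
  have s0: "slope m \<Lambda> 0 = 1"
    using weight_0_gt_1 by (simp add: slope_def)
  have "(1 - \<Lambda> 0) / (\<Lambda> 0 - 1) = -1"
    using weight_0_gt_1 by (simp add: field_simps)
  moreover have "(\<Sum>k=1..<m. (real k + 1) * \<Lambda> k * 1 ^ k) \<ge> 0"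
    using weight_nonneg by (intro sum_nonneg) auto
  ultimately have s1: "slope m \<Lambda> 1 < 0"
    using weight_0_gt_1 unfolding slope_def by simp
  obtain r where r: "0 \<le> r" "r \<le> 1" "slope m \<Lambda> r = 0"
    using IVT2'[of "slope m \<Lambda>" 1 0 0] s0 s1 continuous_on_slope by auto
  moreover have "r \<noteq> 0" "r \<noteq> 1" using r s0 s1 by auto
  ultimately have "r \<in> {0<..<1} \<and> radius_equation m \<Lambda> r"
    by (simp add: radius_equation_iff_slope)
  moreover have "r' = r" if "r' \<in> {0<..<1} \<and> radius_equation m \<Lambda> r'" for r'
    using slope_strict_decreasing[of r r'] slope_strict_decreasing[of r' r] that r
    by (cases r r' rule: linorder_cases) (auto simp: radius_equation_iff_slope)
  ultimately show ?thesis by blast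
qed

lemma schlicht_radius_has_derivative:
  assumes "r < \<Lambda> 0"
  shows "(schlicht_radius m \<Lambda> has_real_derivative slope m \<Lambda> r) (at r)"
proof -
  have "1 - r / \<Lambda> 0 > 0" using assms weight_0_gt_1 by simp
  then have "((\<lambda>r. ln (1 - r / \<Lambda> 0)) has_real_derivative - (1 / \<Lambda> 0) / (1 - r / \<Lambda> 0)) (at r)"
    using weight_0_gt_1 by (auto intro!: derivative_eq_intros)
  moreover have "- (1 / \<Lambda> 0) / (1 - r / \<Lambda> 0) = - (1 / (\<Lambda> 0 - r))"
    using assms weight_0_gt_1 by (simp add: field_simps)
  ultimately have "((\<lambda>r. ln (1 - r / \<Lambda> 0)) has_real_derivative - (1 / (\<Lambda> 0 - r))) (at r)"
    by simp
  moreover have "((\<lambda>r. \<Sum>k=1..<m. \<Lambda> k * r ^ (k + 1)) has_real_derivative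
      (\<Sum>k=1..<m. (real k + 1) * \<Lambda> k * r ^ k)) (at r)"
    by (intro DERIV_sum) (auto intro!: derivative_eq_intros simp: algebra_simps simp del: power_Suc)
  ultimately have "(schlicht_radius m \<Lambda> has_real_derivative
      (\<Lambda> 0)\<^sup>2 * 1 + (\<Lambda> 0 ^ 3 - \<Lambda> 0) * - (1 / (\<Lambda> 0 - r))
      - (\<Sum>k=1..<m. (real k + 1) * \<Lambda> k * r ^ k)) (at r)"
    unfolding schlicht_radius_def
    by (intro DERIV_diff DERIV_add DERIV_cmult DERIV_ident)
  then show ?thesis
    using slope_eq[of r \<Lambda> m, OF assms] by simp
qed

lemma schlicht_radius_0 [simp]: "schlicht_radius m \<Lambda> 0 = 0"
  by (simp add: schlicht_radius_def)

text \<open>At a real point \<open>cnj z ^ k * z\<close> is an ordinary power and the principal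
  logarithm has a positive argument. Both sharpness claims are read off from this restriction to the
  real axis.\<close>

lemma extremal_fun_of_real:
  assumes "x < \<Lambda> 0"
  shows "extremal_fun m \<Lambda> (of_real x) = of_real (schlicht_radius m \<Lambda> x)"
proof -
  have "1 - x / \<Lambda> 0 > 0" using assms weight_0_gt_1 by simp
  then have "Ln (of_real (1 - x / \<Lambda> 0)) = of_real (ln (1 - x / \<Lambda> 0))"
    by (rule Ln_of_real)
  then show ?thesis
    by (simp add: extremal_fun_def schlicht_radius_def mult_ac)
qed

section \<open>The extremal function satisfies the hypotheses\<close>

text \<open>Component 0 is the antiderivative, vanishing at 0, of the equality case of the
  Schwarz-Pick bound on the positive axis. The other components have derivatives of the largest
  allowed modulus, with the sign that works against component 0 there.\<close>

definition extremal_component :: "nat \<Rightarrow> complex \<Rightarrow> complex" where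
  "extremal_component k z =
     (if k = 0 then of_real ((\<Lambda> 0)\<^sup>2) * z + of_real (\<Lambda> 0 ^ 3 - \<Lambda> 0) * Ln (1 - z / of_real (\<Lambda> 0))
      else - of_real (\<Lambda> k) * z)"

lemma extremal_component_0_has_derivative:
  assumes "norm z < 1"
  shows "(extremal_component 0 has_field_derivative
           of_real (\<Lambda> 0) * (1 - of_real (\<Lambda> 0) * z) / (of_real (\<Lambda> 0) - z)) (at z)"
proof -
  have L: "\<Lambda> 0 > 0" using weight_0_gt_1 by simp
  have nz: "of_real (\<Lambda> 0) - z \<noteq> 0"
    using assms weight_0_gt_1 by (metis eq_iff_diff_eq_0 norm_of_real abs_of_pos L less_asym)
  \<comment> \<open>The argument of \<open>Ln\<close> has positive real part and so avoids the
    branch cut.\<close>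
  have "Re (z / of_real (\<Lambda> 0)) < 1"
    using complex_Re_le_cmod[of z] assms weight_0_gt_1 by simp
  then have slit: "1 - z / of_real (\<Lambda> 0) \<notin> \<real>\<^sub>\<le>\<^sub>0"
    by (auto simp: complex_nonpos_Reals_iff)
  have "((\<lambda>z. Ln (1 - z / of_real (\<Lambda> 0))) has_field_derivative
      inverse (1 - z / of_real (\<Lambda> 0)) * - (1 / of_real (\<Lambda> 0))) (at z)"
    using slit L by (auto intro!: derivative_eq_intros)
  moreover have "inverse (1 - z / of_real (\<Lambda> 0)) * - (1 / of_real (\<Lambda> 0)) = - 1 / (of_real (\<Lambda> 0) - z)"
    using L nz by (simp add: field_simps)
  ultimately have "((\<lambda>z. Ln (1 - z / of_real (\<Lambda> 0))) has_field_derivative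
      - 1 / (of_real (\<Lambda> 0) - z)) (at z)" by simp
  then have "((\<lambda>z. of_real ((\<Lambda> 0)\<^sup>2) * z + of_real (\<Lambda> 0 ^ 3 - \<Lambda> 0) * Ln (1 - z / of_real (\<Lambda> 0)))
      has_field_derivative
      of_real ((\<Lambda> 0)\<^sup>2) * 1 + of_real (\<Lambda> 0 ^ 3 - \<Lambda> 0) * (- 1 / (of_real (\<Lambda> 0) - z))) (at z)"
    by (intro DERIV_add DERIV_cmult DERIV_ident)
  moreover have "of_real ((\<Lambda> 0)\<^sup>2) * 1 + of_real (\<Lambda> 0 ^ 3 - \<Lambda> 0) * (- 1 / (of_real (\<Lambda> 0) - z))
      = of_real (\<Lambda> 0) * (1 - of_real (\<Lambda> 0) * z) / (of_real (\<Lambda> 0) - z)"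
    using nz by (simp add: field_simps power2_eq_square power3_eq_cube)
  moreover have "extremal_component 0 = (\<lambda>z. of_real ((\<Lambda> 0)\<^sup>2) * z
      + of_real (\<Lambda> 0 ^ 3 - \<Lambda> 0) * Ln (1 - z / of_real (\<Lambda> 0)))"
    by (simp add: extremal_component_def fun_eq_iff)
  ultimately show ?thesis by simp
qed

lemma landau_hypotheses_extremal:
  "landau_hypotheses m \<Lambda> extremal_component (extremal_fun m \<Lambda>)"
proof -
  have d0: "deriv (extremal_component 0) z
      = of_real (\<Lambda> 0) * (1 - of_real (\<Lambda> 0) * z) / (of_real (\<Lambda> 0) - z)" if "norm z < 1" for z
    using extremal_component_0_has_derivative[OF that] by (rule DERIV_imp_deriv)
  have dk: "(extremal_component k has_field_derivative - of_real (\<Lambda> k)) (at z)" if "k \<ge> 1" for k z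
    unfolding extremal_component_def using that by (auto intro!: derivative_eq_intros)
  have "extremal_component k holomorphic_on ball 0 1" for k
  proof (cases "k = 0")
    case True
    show ?thesis
      unfolding holomorphic_on_open[OF open_ball] True
      by (intro ballI exI, rule extremal_component_0_has_derivative) simp
  next
    case False
    then show ?thesis using dk[of k] by (auto simp: holomorphic_on_open)
  qed
  moreover have "extremal_fun m \<Lambda> z = (\<Sum>k<m. cnj z ^ k * extremal_component k z)" for z
    using m_ge_1
    by (simp add: lessThan_split_0 extremal_fun_def extremal_component_def sum_negf mult_ac)
  ultimately have pa: "polyanalytic_with m extremal_component (extremal_fun m \<Lambda>) (ball 0 1)"
    by (simp add: polyanalytic_with_def)
  have "wirtinger_dz (extremal_fun m \<Lambda>) 0 = 1"
    using wirtinger_dz_polyanalytic_0[OF pa m_ge_1] d0[of 0] weight_0_gt_1 by simp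
  moreover have "norm (deriv (extremal_component 0) z) < \<Lambda> 0" if z: "norm z < 1" for z
  proof -
    \<comment> \<open>This difference of squares shows that
      \<open>(1 - \<Lambda> 0 * z) / (\<Lambda> 0 - z)\<close> maps the disc into itself, whence the
      strict bound.\<close>
    have "(norm (of_real (\<Lambda> 0) - z))\<^sup>2 - (norm (of_real 1 - of_real (\<Lambda> 0) * z))\<^sup>2
        = ((\<Lambda> 0)\<^sup>2 - 1) * (1 - (norm z)\<^sup>2)"
      unfolding norm_sq_diff_eq by (simp add: norm_mult algebra_simps power2_eq_square)
    moreover have "(norm z)\<^sup>2 < 1" using z by (simp add: power_less_one_iff)
    moreover have "(\<Lambda> 0)\<^sup>2 > 1" using weight_0_gt_1 by simp
    ultimately have "(norm (of_real 1 - of_real (\<Lambda> 0) * z))\<^sup>2 < (norm (of_real (\<Lambda> 0) - z))\<^sup>2"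
      by (smt (verit) mult_pos_pos)
    then have lt: "norm (1 - of_real (\<Lambda> 0) * z) < norm (of_real (\<Lambda> 0) - z)"
      by (auto dest: power_less_imp_less_base)
    then have "norm (of_real (\<Lambda> 0) - z) > 0"
      using norm_ge_zero order_le_less_trans by blast
    with lt show ?thesis
      unfolding d0[OF z] norm_divide norm_mult using weight_0_gt_1
      by (simp add: pos_divide_less_eq)
  qed
  moreover have "norm (deriv (extremal_component k) z) \<le> \<Lambda> k" if "k \<in> {1..<m}" for k z
    using DERIV_imp_deriv[OF dk[of k z]] that weight_nonneg[OF that] by simp
  moreover have "extremal_component k 0 = 0" for k
    by (simp add: extremal_component_def)
  ultimately show ?thesis
    using pa by (simp add: landau_hypotheses_def)
qed

end

section \<open>Directional growth of a function satisfying the hypotheses\<close>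

locale landau_function = landau_weights +
  fixes f :: "nat \<Rightarrow> complex \<Rightarrow> complex" and F :: "complex \<Rightarrow> complex"
  assumes hyps: "landau_hypotheses m \<Lambda> f F"
begin

lemma polyanalytic: "polyanalytic_with m f F (ball 0 1)"
  using hyps by (simp add: landau_hypotheses_def)

lemma holomorphic_component: "k < m \<Longrightarrow> f k holomorphic_on ball 0 1"
  using polyanalytic by (simp add: polyanalytic_with_def)

lemma F_eq: "norm z < 1 \<Longrightarrow> F z = f 0 z + (\<Sum>k=1..<m. cnj z ^ k * f k z)"
  using polyanalytic m_ge_1 by (simp add: polyanalytic_with_def lessThan_split_0)

lemma component_0: "k < m \<Longrightarrow> f k 0 = 0"
  using hyps by (simp add: landau_hypotheses_def)

lemma F_0 [simp]: "F 0 = 0"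
  using F_eq[of 0] component_0 m_ge_1 by simp

lemma deriv_bound: "k \<in> {1..<m} \<Longrightarrow> norm z < 1 \<Longrightarrow> norm (deriv (f k) z) \<le> \<Lambda> k"
  using hyps by (simp add: landau_hypotheses_def)

lemma component_bound:
  assumes "k \<in> {1..<m}" and "norm z < 1"
  shows "norm (f k z) \<le> \<Lambda> k * norm z"
proof -
  have "norm (f k z - f k 0) \<le> \<Lambda> k * norm (z - 0)"
  proof (rule field_differentiable_bound[of "ball 0 1" "f k" "deriv (f k)"])
    fix w :: complex assume w: "w \<in> ball 0 1"
    show "(f k has_field_derivative deriv (f k) w) (at w within ball 0 1)"
      using w assms holomorphic_derivI[OF holomorphic_component, of k w] by auto
    show "norm (deriv (f k) w) \<le> \<Lambda> k" using w assms deriv_bound by simp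
  qed (use assms in auto)
  then show ?thesis using component_0 assms by simp
qed

lemma Re_deriv_0_bound:
  assumes "norm z < 1"
  shows "\<Lambda> 0 * ((1 - \<Lambda> 0 * norm z) / (\<Lambda> 0 - norm z)) \<le> Re (deriv (f 0) z)"
proof (rule Schwarz_Pick_Re_bound)
  show "deriv (f 0) holomorphic_on ball 0 1"
    using holomorphic_component m_ge_1 by (intro holomorphic_deriv) auto
  show "deriv (f 0) 0 = 1"
    using hyps wirtinger_dz_polyanalytic_0[OF polyanalytic m_ge_1]
    by (simp add: landau_hypotheses_def)
qed (use hyps assms weight_0_gt_1 in \<open>auto simp: landau_hypotheses_def\<close>)

text \<open>The quantity bounded is the real inner product of \<open>w\<close> with its image under
  the derivative. Component \<open>k\<close> costs at most \<open>\<Lambda> k * norm z ^ k\<close>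
  in the complex-linear part and \<open>k\<close> times that in the conjugate-linear part, which
  explains the factor \<open>k + 1\<close> in the slope.\<close>

lemma directional_derivative_bound:
  assumes z: "norm z < 1"
  obtains F' where "(F has_derivative F') (at z)"
    and "\<And>w. Re (cnj w * F' w) \<ge> slope m \<Lambda> (norm z) * (norm w)\<^sup>2"
proof -
  define A B where "A = (\<Sum>k=1..<m. cnj z ^ k * deriv (f k) z)"
    and "B = (\<Sum>k=1..<m. of_nat k * cnj z ^ (k - 1) * f k z)"
  have d: "(F has_derivative (\<lambda>w. (deriv (f 0) z + A) * w + B * cnj w)) (at z)"
    using polyanalytic_has_derivative[OF polyanalytic, of z] z m_ge_1
    by (simp add: lessThan_split_0 A_def B_def)
  have "norm A \<le> (\<Sum>k=1..<m. norm z ^ k * \<Lambda> k)"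
    unfolding A_def using z deriv_bound
    by (intro sum_norm_le) (auto simp: norm_mult norm_power intro!: mult_left_mono)
  moreover have "norm B \<le> (\<Sum>k=1..<m. real k * norm z ^ k * \<Lambda> k)"
    unfolding B_def
  proof (rule sum_norm_le)
    fix k assume k: "k \<in> {1..<m}"
    \<comment> \<open>Since \<open>f k\<close> vanishes at 0, its bound carries a factor
      \<open>norm z\<close>, which lifts the exponent \<open>k - 1\<close> to
      \<open>k\<close>.\<close>
    have "norm (of_nat k * cnj z ^ (k - 1) * f k z) \<le> real k * norm z ^ (k - 1) * (\<Lambda> k * norm z)"
      using component_bound[OF k z] by (auto simp: norm_mult norm_power intro!: mult_left_mono)
    also have "\<dots> = real k * norm z ^ k * \<Lambda> k"
      using k by (cases k) auto
    finally show "norm (of_nat k * cnj z ^ (k - 1) * f k z) \<le> \<dots>" .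
  qed
  ultimately have "norm A + norm B \<le> (\<Sum>k=1..<m. (real k + 1) * \<Lambda> k * norm z ^ k)"
    by (simp add: algebra_simps sum.distrib)
  then have key: "slope m \<Lambda> (norm z) \<le> Re (deriv (f 0) z) - (norm A + norm B)"
    using Re_deriv_0_bound[OF z] by (simp add: slope_def)
  have "Re (cnj w * ((deriv (f 0) z + A) * w + B * cnj w)) \<ge> slope m \<Lambda> (norm z) * (norm w)\<^sup>2" for w
  proof -
    have "cnj w * ((deriv (f 0) z + A) * w + B * cnj w)
        = of_real ((norm w)\<^sup>2) * deriv (f 0) z + (of_real ((norm w)\<^sup>2) * A + B * (cnj w)\<^sup>2)"
      unfolding complex_norm_square by (simp add: algebra_simps power2_eq_square)
    then have "Re (cnj w * ((deriv (f 0) z + A) * w + B * cnj w))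
        = (norm w)\<^sup>2 * Re (deriv (f 0) z) + Re (of_real ((norm w)\<^sup>2) * A + B * (cnj w)\<^sup>2)"
      by (simp del: of_real_power)
    moreover have "norm (of_real ((norm w)\<^sup>2) * A + B * (cnj w)\<^sup>2) \<le> (norm w)\<^sup>2 * norm A + norm B * (norm w)\<^sup>2"
      by (rule order_trans[OF norm_triangle_ineq]) (simp add: norm_mult norm_power)
    moreover have "- Re u \<le> norm u" for u using abs_Re_le_cmod[of u] by linarith
    ultimately have "Re (cnj w * ((deriv (f 0) z + A) * w + B * cnj w))
        \<ge> (Re (deriv (f 0) z) - (norm A + norm B)) * (norm w)\<^sup>2"
      by (smt (verit) distrib_right left_diff_distrib mult.commute)
    then show ?thesis using mult_right_mono[OF key, of "(norm w)\<^sup>2"] by simp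
  qed
  with d show ?thesis by (rule that)
qed

lemma continuous_on_F: "continuous_on (ball 0 1) F"
proof (rule continuous_at_imp_continuous_on, rule ballI)
  fix z :: complex assume "z \<in> ball 0 1"
  then have "norm z < 1" by simp
  then show "isCont F z"
    by (metis directional_derivative_bound has_derivative_continuous)
qed

text \<open>Tracking the component of \<open>F\<close> in the direction of travel reduces the chord
  and the radius arguments to one-variable monotonicity.\<close>

lemma segment_derivative:
  assumes "norm (a + of_real t * w) < 1"
  shows "\<exists>y. ((\<lambda>t. Re (cnj w * F (a + of_real t * w))) has_real_derivative y) (at t) \<and>
    slope m \<Lambda> (norm (a + of_real t * w)) * (norm w)\<^sup>2 \<le> y"
proof -
  obtain F' where F': "(F has_derivative F') (at (a + of_real t * w))"
    and bound: "\<And>v. slope m \<Lambda> (norm (a + of_real t * w)) * (norm v)\<^sup>2 \<le> Re (cnj v * F' v)"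
    using directional_derivative_bound[OF assms] by blast
  have "((\<lambda>t. a + of_real t * w) has_derivative (\<lambda>x. of_real x * w)) (at t)"
    by (auto intro!: derivative_eq_intros)
  then have "((\<lambda>t. F (a + of_real t * w)) has_derivative (\<lambda>x. F' (of_real x * w))) (at t)"
    using F' by (rule has_derivative_compose)
  then have "((\<lambda>t. Re (cnj w * F (a + of_real t * w))) has_derivative
      (\<lambda>x. Re (cnj w * F' (of_real x * w)))) (at t)"
    by (intro has_derivative_Re has_derivative_mult_right)
  \<comment> \<open>The derivative is only real-linear, which suffices because \<open>x\<close> is
    real.\<close>
  moreover have "F' (of_real x * w) = of_real x * F' w" for x
    using linear_scale[OF has_derivative_linear[OF F'], of x w] by (simp add: scaleR_conv_of_real)
  then have "(\<lambda>x. Re (cnj w * F' (of_real x * w))) = (*) (Re (cnj w * F' w))"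
    by (auto simp: algebra_simps)
  ultimately show ?thesis
    using bound[of w] by (auto simp: has_field_derivative_def)
qed

lemma norm_F_lower_bound:
  assumes z: "norm z < 1"
  shows "schlicht_radius m \<Lambda> (norm z) \<le> norm (F z)"
proof (cases "z = 0")
  case False
  define r where "r = norm z"
  define u where "u = z / of_real r"
  have r: "0 < r" "r < 1" using z False by (auto simp: r_def)
  have nu: "norm u = 1" using r by (simp add: u_def norm_divide r_def)
  have z_eq: "z = of_real r * u" using r by (simp add: u_def)
  \<comment> \<open>\<open>q\<close> vanishes at 0 and its derivative is nonnegative by the slope
    bound; the summand 0 matches the base point \<open>a = 0\<close> of
    \<open>segment_derivative\<close>.\<close>
  define q where "q t = Re (cnj u * F (0 + of_real t * u)) - schlicht_radius m \<Lambda> t" for t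
  have "q 0 \<le> q r"
  proof (rule DERIV_nonneg_imp_nondecreasing[where f = q])
    fix t assume t: "0 \<le> t" "t \<le> r"
    have nt: "norm (0 + of_real t * u) = t" using t nu by (simp add: norm_mult)
    have "t < 1" using t r by simp
    then obtain y where "((\<lambda>t. Re (cnj u * F (0 + of_real t * u))) has_real_derivative y) (at t)"
      and "slope m \<Lambda> t \<le> y"
      using segment_derivative[of 0 t u] nt nu by auto
    moreover have "(schlicht_radius m \<Lambda> has_real_derivative slope m \<Lambda> t) (at t)"
      using \<open>t < 1\<close> weight_0_gt_1 by (intro schlicht_radius_has_derivative) simp
    ultimately show "\<exists>y. (q has_real_derivative y) (at t) \<and> 0 \<le> y"
      unfolding q_def by (intro exI[of _ "y - slope m \<Lambda> t"] conjI DERIV_diff) auto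
  qed (use r in auto)
  then have "schlicht_radius m \<Lambda> r \<le> Re (cnj u * F z)"
    by (simp add: q_def z_eq[symmetric])
  also have "\<dots> \<le> norm (cnj u * F z)" by (rule complex_Re_le_cmod)
  finally show ?thesis using nu by (simp add: norm_mult r_def)
qed (use F_0 in simp)

end

section \<open>The covering radius on both sides of the root\<close>

locale landau_radius = landau_weights +
  fixes r\<^sub>3 :: real
  assumes root_pos: "0 < r\<^sub>3" and root_less_1: "r\<^sub>3 < 1" and slope_root: "slope m \<Lambda> r\<^sub>3 = 0"
begin

lemma slope_pos: "0 \<le> r \<Longrightarrow> r < r\<^sub>3 \<Longrightarrow> 0 < slope m \<Lambda> r"
  using slope_strict_decreasing[of r r\<^sub>3] root_less_1 slope_root by simp

lemma slope_neg: "r\<^sub>3 < r \<Longrightarrow> r \<le> 1 \<Longrightarrow> slope m \<Lambda> r < 0"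
  using slope_strict_decreasing[of r\<^sub>3 r] root_pos slope_root by simp

lemma continuous_on_schlicht_radius: "b \<le> 1 \<Longrightarrow> continuous_on {a..b} (schlicht_radius m \<Lambda>)"
  using weight_0_gt_1
  by (intro continuous_at_imp_continuous_on ballI DERIV_isCont[OF schlicht_radius_has_derivative]) auto

lemma schlicht_radius_pos: "0 < schlicht_radius m \<Lambda> r\<^sub>3"
proof -
  have "schlicht_radius m \<Lambda> 0 < schlicht_radius m \<Lambda> r\<^sub>3"
  proof (rule DERIV_pos_imp_increasing_open[OF root_pos])
    fix x assume "0 < x" "x < r\<^sub>3"
    then show "\<exists>y. (schlicht_radius m \<Lambda> has_real_derivative y) (at x) \<and> 0 < y"
      using schlicht_radius_has_derivative[of x] slope_pos[of x] root_less_1 weight_0_gt_1 by auto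
  qed (use continuous_on_schlicht_radius root_less_1 in simp)
  then show ?thesis by simp
qed

lemma schlicht_radius_less:
  assumes "r\<^sub>3 < r" "r \<le> 1"
  shows "schlicht_radius m \<Lambda> r < schlicht_radius m \<Lambda> r\<^sub>3"
proof (rule DERIV_neg_imp_decreasing_open[OF assms(1)])
  fix x assume "r\<^sub>3 < x" "x < r"
  then show "\<exists>y. (schlicht_radius m \<Lambda> has_real_derivative y) (at x) \<and> y < 0"
    using schlicht_radius_has_derivative[of x] slope_neg[of x] assms(2) weight_0_gt_1 by auto
qed (use continuous_on_schlicht_radius assms in simp)

text \<open>On the real axis the extremal function is \<open>schlicht_radius m \<Lambda>\<close>, which increases up to
  \<open>r\<^sub>3\<close> and decreases afterwards.\<close>

lemma extremal_fun_not_inj_on: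
  assumes "r\<^sub>3 < r" "r \<le> 1"
  shows "\<not> inj_on (extremal_fun m \<Lambda>) (ball 0 r)"
proof
  assume inj: "inj_on (extremal_fun m \<Lambda>) (ball 0 r)"
  \<comment> \<open>Staying strictly below \<open>r\<close> keeps the second preimage inside the
    open disc.\<close>
  obtain s where s: "r\<^sub>3 < s" "s < r" using dense assms by blast
  \<comment> \<open>The profile may be negative at \<open>s\<close>; the maximum with 0 makes the
    level \<open>v\<close> attained on both sides of the root.\<close>
  define v where "v = max 0 (schlicht_radius m \<Lambda> s)"
  have v: "v < schlicht_radius m \<Lambda> r\<^sub>3"
    using schlicht_radius_pos schlicht_radius_less[of s] s assms by (simp add: v_def)
  obtain x where x: "0 \<le> x" "x \<le> r\<^sub>3" "schlicht_radius m \<Lambda> x = v"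
    using IVT'[of "schlicht_radius m \<Lambda>" 0 v r\<^sub>3] v root_pos root_less_1
      continuous_on_schlicht_radius[of r\<^sub>3 0] by (auto simp: v_def)
  obtain y where y: "r\<^sub>3 \<le> y" "y \<le> s" "schlicht_radius m \<Lambda> y = v"
    using IVT2'[of "schlicht_radius m \<Lambda>" s v r\<^sub>3] v s assms
      continuous_on_schlicht_radius[of s r\<^sub>3] by (auto simp: v_def)
  have "extremal_fun m \<Lambda> (of_real x) = extremal_fun m \<Lambda> (of_real y)"
    using x y s assms weight_0_gt_1 by (simp add: extremal_fun_of_real)
  moreover have "of_real x \<in> ball (0::complex) r" "of_real y \<in> ball (0::complex) r"
    using x y s root_pos by auto
  ultimately have "complex_of_real x = of_real y" using inj by (meson inj_onD)
  then show False using x y v by auto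
qed

end

section \<open>Univalence and the covered disc\<close>

locale landau_function_radius = landau_function + landau_radius
begin

text \<open>Injectivity reaches the boundary circle, since the interior of a chord stays in the open disc.
  The sharpness of the covering radius needs this.\<close>

lemma inj_on_cball: "inj_on F (cball 0 r\<^sub>3)"
proof (rule inj_onI, rule ccontr)
  fix a b assume a: "a \<in> cball 0 r\<^sub>3" and b: "b \<in> cball 0 r\<^sub>3" and eq: "F a = F b" and "a \<noteq> b"
  define w where "w = b - a"
  have seg: "norm (a + of_real t * w) \<le> r\<^sub>3" if "0 \<le> t" "t \<le> 1" for t
  proof -
    have "(1 - t) *\<^sub>R a + t *\<^sub>R b \<in> cball 0 r\<^sub>3"
      using convexD_alt[OF convex_cball a b that] .
    then show ?thesis by (simp add: w_def scaleR_conv_of_real algebra_simps)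
  qed
  \<comment> \<open>Strict convexity of the disc: even between two boundary points the interior of
    the chord lies in the open disc.\<close>
  have seg_open: "norm (a + of_real t * w) < r\<^sub>3" if "0 < t" "t < 1" for t
  proof -
    have "a + of_real t * w \<in> open_segment a b"
      using that \<open>a \<noteq> b\<close> by (auto simp: in_segment w_def scaleR_conv_of_real algebra_simps)
    then show ?thesis
      using dist_decreases_open_segment[of "a + of_real t * w" a b 0] a b by auto
  qed
  define h where "h t = Re (cnj w * F (a + of_real t * w))" for t
  have "h 0 < h 1"
  \<comment> \<open>The slope may vanish at endpoints on the circle, so positivity is used only in
    the interior, with continuity at the ends.\<close>
  proof (rule DERIV_pos_imp_increasing_open[where f = h])
    fix t :: real assume t: "0 < t" "t < 1"
    have "0 < slope m \<Lambda> (norm (a + of_real t * w)) * (norm w)\<^sup>2"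
      using slope_pos[OF norm_ge_zero seg_open[OF t]] \<open>a \<noteq> b\<close> by (simp add: w_def)
    then show "\<exists>y. (h has_real_derivative y) (at t) \<and> 0 < y"
      using segment_derivative[of a t w] seg_open[OF t] root_less_1 unfolding h_def
      by fastforce
  next
    have "\<exists>y. (h has_real_derivative y) (at t)" if "t \<in> {0..1}" for t
      using segment_derivative[of a t w] seg[of t] that root_less_1 unfolding h_def
      by fastforce
    then show "continuous_on {0..1} h"
      by (meson DERIV_isCont continuous_at_imp_continuous_on)
  qed simp
  then show False using eq by (simp add: h_def w_def)
qed

lemma inj_on_ball: "inj_on F (ball 0 r\<^sub>3)"
  using inj_on_cball by (rule inj_on_subset) auto

text \<open>The part of the disc covered by \<open>F\<close> is open by invariance of domain. It is
  also relatively closed, because it equals the part covered by the compact image of the closed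
  disc. Being nonempty, it is the whole disc.\<close>

lemma contains_schlicht_disc:
  "contains_schlicht_disc F (ball 0 r\<^sub>3) (schlicht_radius m \<Lambda> r\<^sub>3)"
proof -
  let ?B = "ball (0::complex) r\<^sub>3" and ?D = "ball (0::complex) (schlicht_radius m \<Lambda> r\<^sub>3)"
  have cont: "continuous_on (cball 0 r\<^sub>3) F"
    by (rule continuous_on_subset[OF continuous_on_F]) (use root_less_1 in auto)
  have contB: "continuous_on ?B F" by (rule continuous_on_subset[OF cont]) auto
  have openB: "open (F ` ?B)"
    using contB inj_on_ball by (intro invariance_of_domain) auto
  have closedB: "closed (F ` cball 0 r\<^sub>3)"
    using cont by (intro compact_imp_closed compact_continuous_image) auto
  \<comment> \<open>On the circle of radius \<open>r\<^sub>3\<close> the lower bound puts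
    \<open>F z\<close> outside the open disc \<open>?D\<close>.\<close>
  have inter: "?D \<inter> F ` cball 0 r\<^sub>3 = ?D \<inter> F ` ?B"
  proof -
    have "z \<in> ?B" if "z \<in> cball 0 r\<^sub>3" "F z \<in> ?D" for z
      using norm_F_lower_bound[of z] that root_less_1 by (cases "norm z = r\<^sub>3") auto
    then show ?thesis by auto
  qed
  have "F ` ?B \<inter> ?D = {} \<or> ?D \<subseteq> F ` ?B"
  proof -
    have "?D \<inter> F ` ?B = {} \<or> ?D \<inter> F ` ?B = ?D"
    proof (rule connected_clopen[THEN iffD1, rule_format, OF connected_ball])
      show "openin (top_of_set ?D) (?D \<inter> F ` ?B) \<and> closedin (top_of_set ?D) (?D \<inter> F ` ?B)"
        using openB closedB by (metis inter openin_open_Int closedin_closed_Int)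
    qed
    then show ?thesis by auto
  qed
  moreover have "0 \<in> F ` ?B \<inter> ?D"
    using F_0 root_pos schlicht_radius_pos by (force intro!: image_eqI[of _ _ 0])
  ultimately have sub: "?D \<subseteq> F ` ?B" by blast
  obtain g where g: "homeomorphism ?B (F ` ?B) F g"
    using invariance_of_domain_homeomorphism[OF open_ball contB _ inj_on_ball] by auto
  \<comment> \<open>The subdomain is the preimage of the disc, written as an image under the inverse
    \<open>g\<close> so that connectedness and openness transfer.\<close>
  define U where "U = g ` ?D"
  have U_B: "U \<subseteq> ?B" using g sub by (auto simp: U_def homeomorphism_def)
  have hU: "homeomorphism ?D U g F"
    unfolding U_def using homeomorphism_of_subsets[OF homeomorphism_symD[OF g] sub] U_B by (auto simp: U_def)
  have "F ` U = ?D" using hU by (simp add: homeomorphism_def)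
  moreover have "inj_on F U" using inj_on_ball U_B by (rule inj_on_subset)
  moreover have "connected U"
    using hU connected_continuous_image[of ?D g] connected_ball by (auto simp: homeomorphism_def)
  moreover have "open U"
    unfolding U_def using hU
    by (intro invariance_of_domain) (auto simp: homeomorphism_def intro: inj_on_inverseI)
  moreover have "U \<noteq> {}" using schlicht_radius_pos by (simp add: U_def)
  ultimately show ?thesis
    using U_B by (auto simp: contains_schlicht_disc_def bij_betw_def)
qed

end

section \<open>Sharpness of the covering radius\<close>

context landau_radius
begin

text \<open>The extremal function takes the value
  \<open>schlicht_radius m \<Lambda> r\<^sub>3\<close> at the boundary point
  \<open>r\<^sub>3\<close>. Injectivity on the closed disc prevents any interior point from taking
  it, yet it lies in every larger disc.\<close>

lemma schlicht_radius_sharp: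
  assumes "schlicht_radius m \<Lambda> r\<^sub>3 < R"
  shows "\<not> ball 0 R \<subseteq> extremal_fun m \<Lambda> ` ball 0 r\<^sub>3"
proof
  interpret landau_function_radius m \<Lambda> extremal_component "extremal_fun m \<Lambda>" r\<^sub>3
    by unfold_locales (rule landau_hypotheses_extremal)
  assume sub: "ball 0 R \<subseteq> extremal_fun m \<Lambda> ` ball 0 r\<^sub>3"
  have "extremal_fun m \<Lambda> (of_real r\<^sub>3) \<in> ball 0 R"
    using assms schlicht_radius_pos root_less_1 weight_0_gt_1 by (simp add: extremal_fun_of_real)
  then obtain z where z: "z \<in> ball 0 r\<^sub>3" "extremal_fun m \<Lambda> (of_real r\<^sub>3) = extremal_fun m \<Lambda> z"
    using sub by blast
  then have "of_real r\<^sub>3 = z"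
    using inj_onD[OF inj_on_cball, of "of_real r\<^sub>3" z] root_pos by simp
  then show False using z root_pos by auto
qed

end

theorem theorem3p3:
  fixes m :: nat and \<Lambda> :: "nat \<Rightarrow> real"
  assumes "m \<ge> 1"
    and "\<forall>k\<in>{1..<m}. \<Lambda> k \<ge> 0"
    and "\<Lambda> 0 > 1"
  shows "(\<exists>!r. r \<in> {0<..<1} \<and> radius_equation m \<Lambda> r) \<and>
    (\<forall>r\<^sub>3 R\<^sub>3. r\<^sub>3 \<in> {0<..<1} \<and> radius_equation m \<Lambda> r\<^sub>3 \<and> R\<^sub>3 = schlicht_radius m \<Lambda> r\<^sub>3 \<longrightarrow>
      (\<forall>f F. landau_hypotheses m \<Lambda> f F \<longrightarrow>
          inj_on F (ball 0 r\<^sub>3) \<and> contains_schlicht_disc F (ball 0 r\<^sub>3) R\<^sub>3) \<and>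
      (\<exists>f. landau_hypotheses m \<Lambda> f (extremal_fun m \<Lambda>)) \<and>
      (\<forall>r\<in>{r\<^sub>3<..1}. \<not> inj_on (extremal_fun m \<Lambda>) (ball 0 r)) \<and>
      (\<forall>R>R\<^sub>3. \<not> ball 0 R \<subseteq> extremal_fun m \<Lambda> ` ball 0 r\<^sub>3))"
proof (intro conjI allI impI)
  interpret landau_weights m \<Lambda>
    using assms by unfold_locales auto
  show "\<exists>!r. r \<in> {0<..<1} \<and> radius_equation m \<Lambda> r"
    by (rule radius_equation_ex1)
  show "\<exists>f. landau_hypotheses m \<Lambda> f (extremal_fun m \<Lambda>)"
    using landau_hypotheses_extremal by blast
  fix r\<^sub>3 R\<^sub>3
  assume r\<^sub>3: "r\<^sub>3 \<in> {0<..<1} \<and> radius_equation m \<Lambda> r\<^sub>3 \<and> R\<^sub>3 = schlicht_radius m \<Lambda> r\<^sub>3"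
  then interpret landau_radius m \<Lambda> r\<^sub>3
    by unfold_locales (auto simp: radius_equation_iff_slope)
  show "\<forall>r\<in>{r\<^sub>3<..1}. \<not> inj_on (extremal_fun m \<Lambda>) (ball 0 r)"
    using extremal_fun_not_inj_on by simp
  show "\<not> ball 0 R \<subseteq> extremal_fun m \<Lambda> ` ball 0 r\<^sub>3" if "R > R\<^sub>3" for R
    using schlicht_radius_sharp that r\<^sub>3 by simp
  fix f F assume "landau_hypotheses m \<Lambda> f F"
  then interpret landau_function_radius m \<Lambda> f F r\<^sub>3
    by unfold_locales
  show "inj_on F (ball 0 r\<^sub>3)" by (rule inj_on_ball)
  show "contains_schlicht_disc F (ball 0 r\<^sub>3) R\<^sub>3"
    using contains_schlicht_disc r\<^sub>3 by simp
qed

end
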